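(* Let $X$, $Y$ and $Z$ be independent random variables uniformly distributed on $[0,\frac{1}{2}]$, and consider the model $s_0 = 1+X$, $s_1 = s_0+\ell$, $t_0 = 2+Y$, $t_1 = \lfloor s_1\rfloor + 1 + Z$. Then, for a fixed time response bound, an integer $R$, and a positive $h$, the probability of the erroneous decision to grant access, $p_{error}(R,h) = \mathrm{Prob}\{\, t_1 - t_0 \le R \mid s_1 - s_0 = R+h\,\}$, is given by $p_{error}(R,h) = \frac{1}{2}$ if $0 < h \le \frac{1}{2}$; $p_{error}(R,h) = 1-h$ if $\frac{1}{2} < h < 1$; and $p_{error}(R,h) = 0$ if $h \ge 1$.
   Context: Distance-bounding challenge–response round where the verifier executes at most one operation per clock cycle: $s_0$ is the actual time the challenge is sent (within clock cycle 1), $t_0$ the time recorded for sending (within the next cycle), $s_1 = s_0+\ell$ the actual time the response is received, and $t_1$ the time recorded for receiving (within the cycle following $\lfloor s_1\rfloor$). The verifier grants access iff the measured interval satisfies $t_1 - t_0 \le R$. *)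

theory Defs
  imports "HOL-Probability.Probability"
begin

definition uniform_on_Icc :: "'a measure \<Rightarrow> ('a \<Rightarrow> real) \<Rightarrow> real \<Rightarrow> real \<Rightarrow> bool" where
  "uniform_on_Icc M X a b \<longleftrightarrow>
     distributed M lborel X (\<lambda>x. indicator {a..b} x / measure lborel {a..b})"

definition s0 :: "('a \<Rightarrow> real) \<Rightarrow> 'a \<Rightarrow> real" where
  "s0 X \<omega> = 1 + X \<omega>"

definition s1 :: "('a \<Rightarrow> real) \<Rightarrow> real \<Rightarrow> 'a \<Rightarrow> real" where
  "s1 X l \<omega> = s0 X \<omega> + l"

definition t0 :: "('a \<Rightarrow> real) \<Rightarrow> 'a \<Rightarrow> real" where
  "t0 Y \<omega> = 2 + Y \<omega>"

definition t1 :: "('a \<Rightarrow> real) \<Rightarrow> ('a \<Rightarrow> real) \<Rightarrow> real \<Rightarrow> 'a \<Rightarrow> real" where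
  "t1 X Z l \<omega> = real_of_int \<lfloor>s1 X l \<omega>\<rfloor> + 1 + Z \<omega>"

text \<open>The round-trip time \<open>l = s1 - s0\<close> is a deterministic parameter of the model, not a random
  variable. The conditioning event \<open>s1 - s0 = R + h\<close> therefore has positive probability only
  in the model with \<open>l = R + h\<close>, and the conditional probability is taken there.\<close>

definition p_error ::
  "'a measure \<Rightarrow> ('a \<Rightarrow> real) \<Rightarrow> ('a \<Rightarrow> real) \<Rightarrow> ('a \<Rightarrow> real) \<Rightarrow> int \<Rightarrow> real \<Rightarrow> real" where
  "p_error M X Y Z R h =
     (let l = real_of_int R + h in
       \<P>(\<omega> in M. t1 X Z l \<omega> - t0 Y \<omega> \<le> real_of_int R \<bar> s1 X l \<omega> - s0 X \<omega> = real_of_int R + h))"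

end

theory Submission
  imports Defs
begin

text \<open>
  Since \<open>R\<close> is an integer, \<open>t1 - t0 \<le> R\<close> says \<open>\<lfloor>X + h\<rfloor> + Z \<le> Y\<close>. As \<open>\<bar>Y - Z\<bar> \<le> 1/2\<close>, this forces
  \<open>\<lfloor>X + h\<rfloor> = 0\<close>, i.e. \<open>X < 1 - h\<close>, and then becomes \<open>Z \<le> Y\<close>. These two events are independent, and
  the second has probability \<open>1/2\<close> by symmetry.
\<close>

text \<open>Exchangeability: \<open>(Y, Z)\<close> and \<open>(Z, Y)\<close> have the same law, so
  \<open>Z \<le> Y\<close> and \<open>Y \<le> Z\<close> are equally likely. The two events cover the
  space and overlap only where \<open>Y = Z\<close>, which is null because the common law has no
  atoms.\<close>

lemma (in prob_space) prob_le_iid_atomless: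
  fixes Y Z :: "'a \<Rightarrow> real"
  assumes indep: "indep_var borel Y borel Z"
    and eq: "distr M borel Y = distr M borel Z"
    and atomless: "\<And>y. emeasure (distr M borel Y) {y} = 0"
  shows "\<P>(\<omega> in M. Z \<omega> \<le> Y \<omega>) = 1/2"
proof -
  define D where "D = distr M borel Y"
  have [measurable]: "Y \<in> borel_measurable M" "Z \<in> borel_measurable M"
    using indep by (auto dest: indep_var_rv1 indep_var_rv2)
  interpret D: prob_space D
    unfolding D_def by (rule prob_space_distr) simp
  have sets_D [measurable_cong]: "sets D = sets borel"
    by (simp add: D_def)
  have YZ: "distr M (borel \<Otimes>\<^sub>M borel) (\<lambda>\<omega>. (Y \<omega>, Z \<omega>)) = D \<Otimes>\<^sub>M D"
    using indep unfolding indep_var_distribution_eq D_def by (simp add: eq)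
  interpret DD: pair_sigma_finite D D ..
  \<comment> \<open>Both factors are the same measure, so swapping the coordinates preserves the
    product; independence identifies this product with the joint law of \<open>Y\<close> and
    \<open>Z\<close>.\<close>
  have "(D \<Otimes>\<^sub>M D) = distr (D \<Otimes>\<^sub>M D) (D \<Otimes>\<^sub>M D) (\<lambda>(x, y). (y, x))"
    by (rule DD.distr_pair_swap)
  also have "\<dots> = distr (distr M (borel \<Otimes>\<^sub>M borel) (\<lambda>\<omega>. (Y \<omega>, Z \<omega>))) (borel \<Otimes>\<^sub>M borel) (\<lambda>(x, y). (y, x))"
    unfolding YZ by (intro distr_cong sets_pair_measure_cong sets_D refl)
  also have "\<dots> = distr M (borel \<Otimes>\<^sub>M borel) (\<lambda>\<omega>. (Z \<omega>, Y \<omega>))"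
    by (subst distr_distr) (auto simp: comp_def)
  finally have swap: "distr M (borel \<Otimes>\<^sub>M borel) (\<lambda>\<omega>. (Y \<omega>, Z \<omega>)) =
      distr M (borel \<Otimes>\<^sub>M borel) (\<lambda>\<omega>. (Z \<omega>, Y \<omega>))"
    using YZ by simp
  define A where "A = {p \<in> space (borel \<Otimes>\<^sub>M borel :: (real \<times> real) measure). snd p \<le> fst p}"
  have [measurable]: "A \<in> sets (borel \<Otimes>\<^sub>M borel)"
    unfolding A_def by measurable
  have "\<P>(\<omega> in M. Z \<omega> \<le> Y \<omega>) = measure (distr M (borel \<Otimes>\<^sub>M borel) (\<lambda>\<omega>. (Y \<omega>, Z \<omega>))) A"
    by (simp add: measure_distr) (auto simp: A_def space_pair_measure intro!: arg_cong[where f = prob])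
  also have "\<dots> = \<P>(\<omega> in M. Y \<omega> \<le> Z \<omega>)"
    unfolding swap by (simp add: measure_distr) (auto simp: A_def space_pair_measure intro!: arg_cong[where f = prob])
  finally have sym: "\<P>(\<omega> in M. Z \<omega> \<le> Y \<omega>) = \<P>(\<omega> in M. Y \<omega> \<le> Z \<omega>)" .
  define E where "E = {p \<in> space (borel \<Otimes>\<^sub>M borel :: (real \<times> real) measure). fst p = snd p}"
  have [measurable]: "E \<in> sets (borel \<Otimes>\<^sub>M borel)"
    unfolding E_def by measurable
  have "E \<in> sets (D \<Otimes>\<^sub>M D)"
    by measurable
  \<comment> \<open>Fubini on the diagonal: each section is a single point, hence null.\<close>
  then have "emeasure (D \<Otimes>\<^sub>M D) E = (\<integral>\<^sup>+ x. emeasure D (Pair x -` E) \<partial>D)"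
    by (rule D.emeasure_pair_measure_alt)
  also have "\<dots> = (\<integral>\<^sup>+ x. 0 \<partial>D)"
  proof (intro nn_integral_cong)
    fix x
    have "Pair x -` E = {x}"
      by (auto simp: E_def space_pair_measure)
    then show "emeasure D (Pair x -` E) = 0"
      using atomless by (simp add: D_def)
  qed
  finally have "measure (distr M (borel \<Otimes>\<^sub>M borel) (\<lambda>\<omega>. (Y \<omega>, Z \<omega>))) E = 0"
    unfolding YZ by (simp add: measure_def)
  also have "measure (distr M (borel \<Otimes>\<^sub>M borel) (\<lambda>\<omega>. (Y \<omega>, Z \<omega>))) E = \<P>(\<omega> in M. Y \<omega> = Z \<omega>)"
    by (simp add: measure_distr) (auto simp: E_def space_pair_measure intro!: arg_cong[where f = prob])
  finally have "\<P>(\<omega> in M. Y \<omega> = Z \<omega>) = 0" .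
  moreover have "{\<omega> \<in> space M. Z \<omega> \<le> Y \<omega>} \<inter> {\<omega> \<in> space M. Y \<omega> \<le> Z \<omega>} = {\<omega> \<in> space M. Y \<omega> = Z \<omega>}"
    by auto
  moreover have "{\<omega> \<in> space M. Z \<omega> \<le> Y \<omega>} \<union> {\<omega> \<in> space M. Y \<omega> \<le> Z \<omega>} = space M"
    by auto
  moreover have "{\<omega> \<in> space M. Z \<omega> \<le> Y \<omega>} \<in> events" "{\<omega> \<in> space M. Y \<omega> \<le> Z \<omega>} \<in> events"
    by measurable
  \<comment> \<open>Inclusion-exclusion: \<open>1\<close> is the probability of the union and
    \<open>0\<close> that of the intersection.\<close>
  ultimately have "1 + 0 = \<P>(\<omega> in M. Z \<omega> \<le> Y \<omega>) + \<P>(\<omega> in M. Y \<omega> \<le> Z \<omega>)"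
    using measure_Un3[of "{\<omega> \<in> space M. Z \<omega> \<le> Y \<omega>}" M "{\<omega> \<in> space M. Y \<omega> \<le> Z \<omega>}"]
    by (simp add: prob_space fmeasurable_eq_sets)
  with sym show ?thesis
    by simp
qed

text \<open>A law with a Lebesgue density gives no mass to points. This serves both to exchange
  strict and weak inequalities and to rule out atoms.\<close>

lemma (in prob_space) distributed_lborel_AE_neq:
  assumes "distributed M lborel X f"
  shows "AE \<omega> in M. X \<omega> \<noteq> c"
proof -
  have "AE x in lborel. 0 < f x \<longrightarrow> x \<noteq> c"
    using AE_lborel_singleton[of c] by eventually_elim simp
  then show ?thesis
    by (intro iffD2[OF distributed_AE2[OF assms]]) auto
qed

text \<open>The density vanishes off the interval. The law confines a variable to its range only
  almost surely, so the pointwise analysis of acceptance has to be transferred through this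
  fact.\<close>

lemma (in prob_space) uniform_on_Icc_AE_mem:
  assumes "uniform_on_Icc M X a b"
  shows "AE \<omega> in M. X \<omega> \<in> {a..b}"
proof -
  have "AE x in lborel. 0 < ennreal (indicator {a..b} x / measure lborel {a..b}) \<longrightarrow> x \<in> {a..b}"
    by (auto split: split_indicator_asm)
  then show ?thesis
    by (intro iffD2[OF distributed_AE2[OF assms[unfolded uniform_on_Icc_def]]]) auto
qed

text \<open>The strict form of the uniform distribution function is what the floor calls for:
  \<open>\<lfloor>X + h\<rfloor> = 0\<close> excludes the endpoint \<open>X = 1 - h\<close>. The
  excluded point is null.\<close>

lemma (in prob_space) uniform_on_Icc_prob_less:
  assumes X: "uniform_on_Icc M X a b" and "a \<le> t" "t \<le> b"
  shows "\<P>(\<omega> in M. X \<omega> < t) = (t - a) / (b - a)"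
proof -
  have D: "distributed M lborel X (\<lambda>x. indicator {a..b} x / measure lborel {a..b})"
    using X by (simp add: uniform_on_Icc_def)
  have [measurable]: "X \<in> borel_measurable M"
    using distributed_measurable[OF D] by simp
  have "AE \<omega> in M. (X \<omega> < t) = (X \<omega> \<le> t)"
    using distributed_lborel_AE_neq[OF D, of t] by eventually_elim auto
  then have "\<P>(\<omega> in M. X \<omega> < t) = \<P>(\<omega> in M. X \<omega> \<le> t)"
    by (intro prob_eq_AE) auto
  also have "\<dots> = (t - a) / (b - a)"
    using uniform_distributed_measure[OF D] assms by simp
  finally show ?thesis .
qed

text \<open>Pulling the integer \<open>R + 1\<close> out of the floor turns acceptance into
  \<open>\<lfloor>x + h\<rfloor> + z \<le> y\<close>. If \<open>x + h \<ge> 1\<close>, this would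
  need \<open>y - z \<ge> 1\<close>, but \<open>y - z\<close> is at most \<open>1/2\<close>.\<close>

lemma accept_iff:
  fixes h x y z :: real and R :: int
  assumes "h > 0" "x \<in> {0..1/2}" "y \<in> {0..1/2}" "z \<in> {0..1/2}"
  shows "real_of_int \<lfloor>1 + x + (real_of_int R + h)\<rfloor> + 1 + z - (2 + y) \<le> real_of_int R
    \<longleftrightarrow> x < 1 - h \<and> z \<le> y"
proof -
  have "1 + x + (real_of_int R + h) = (x + h) + real_of_int (R + 1)"
    by simp
  then have "\<lfloor>1 + x + (real_of_int R + h)\<rfloor> = \<lfloor>x + h\<rfloor> + (R + 1)"
    by (simp only: floor_add_int)
  then have fl: "real_of_int \<lfloor>1 + x + (real_of_int R + h)\<rfloor> = real_of_int \<lfloor>x + h\<rfloor> + real_of_int R + 1"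
    by simp
  show ?thesis
  proof (cases "x < 1 - h")
    case True
    then have "\<lfloor>x + h\<rfloor> = 0"
      using assms by (intro floor_unique) auto
    with fl True show ?thesis
      by auto
  next
    case False
    then have "1 \<le> \<lfloor>x + h\<rfloor>"
      by (simp add: le_floor_iff)
    then have "1 \<le> real_of_int \<lfloor>x + h\<rfloor>"
      by linarith
    moreover have "y - z \<le> 1/2"
      using assms by simp
    ultimately show ?thesis
      using fl False by linarith
  qed
qed

theorem theorem2:
  fixes M :: "'a measure" and X Y Z :: "'a \<Rightarrow> real" and R :: int and h :: real
  assumes "prob_space M"
    and "prob_space.indep_vars M (\<lambda>_. borel) (\<lambda>i. [X, Y, Z] ! i) {0..<3::nat}"
    and "uniform_on_Icc M X 0 (1/2)"
    and "uniform_on_Icc M Y 0 (1/2)"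
    and "uniform_on_Icc M Z 0 (1/2)"
    and "h > 0"
  shows "(0 < h \<and> h \<le> 1/2 \<longrightarrow> p_error M X Y Z R h = 1/2)
       \<and> (1/2 < h \<and> h < 1 \<longrightarrow> p_error M X Y Z R h = 1 - h)
       \<and> (h \<ge> 1 \<longrightarrow> p_error M X Y Z R h = 0)"
proof -
  interpret prob_space M by fact
  let ?V = "\<lambda>i. [X, Y, Z] ! i"
  let ?r = "\<lambda>A \<omega>. restrict (\<lambda>i. ?V i \<omega>) A"
  \<comment> \<open>Families restricted to disjoint index sets are independent; applying coordinate
    maps to them recovers the variables themselves.\<close>
  have "indep_var borel ((\<lambda>f. f 1) \<circ> ?r {1}) borel ((\<lambda>f. f 2) \<circ> ?r {2})"
    by (rule indep_var_compose[OF indep_var_restrict[OF assms(2)]]) auto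
  also have "(\<lambda>f. f 1) \<circ> ?r {1} = Y"
    by auto
  also have "(\<lambda>f. f 2) \<circ> ?r {2} = Z"
    by auto
  finally have indep_YZ: "indep_var borel Y borel Z" .
  \<comment> \<open>\<open>Y\<close> and \<open>Z\<close> are merged into their difference, whose
    sign decides \<open>Z \<le> Y\<close>, so that independence of two real variables suffices
    below.\<close>
  have "indep_var borel ((\<lambda>f. f 0) \<circ> ?r {0}) borel ((\<lambda>f. f 1 - f 2) \<circ> ?r {1, 2})"
    by (rule indep_var_compose[OF indep_var_restrict[OF assms(2)]]) auto
  also have "(\<lambda>f. f 0) \<circ> ?r {0} = X"
    by auto
  also have "(\<lambda>f. f 1 - f 2) \<circ> ?r {1, 2} = (\<lambda>\<omega>. Y \<omega> - Z \<omega>)"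
    by (auto simp: numeral_2_eq_2)
  finally have indep_X_YZ: "indep_var borel X borel (\<lambda>\<omega>. Y \<omega> - Z \<omega>)" .
  have [measurable]: "X \<in> borel_measurable M" "Y \<in> borel_measurable M" "Z \<in> borel_measurable M"
    using indep_X_YZ indep_YZ by (auto dest: indep_var_rv1 indep_var_rv2)

  \<comment> \<open>\<open>distributed\<close> takes the law on \<open>lborel\<close>; it agrees
    with the law on \<open>borel\<close> since only the measurable sets of the target
    matter.\<close>
  have distr_unif: "distr M borel U = density lborel (\<lambda>x. indicator {0..1/2} x / measure lborel {0..1/2::real})"
    if "uniform_on_Icc M U 0 (1/2)" for U
    using distributed_distr_eq_density[OF that[unfolded uniform_on_Icc_def]]
    by (simp cong: distr_cong)
  have "emeasure (distr M borel Y) {y} = 0" for y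
  proof -
    have "AE \<omega> in M. Y \<omega> \<noteq> y"
      using assms(4) unfolding uniform_on_Icc_def by (rule distributed_lborel_AE_neq)
    then have "emeasure M {\<omega> \<in> space M. \<not> Y \<omega> \<noteq> y} = 0"
      by (subst (asm) AE_iff_measurable[OF _ refl]) auto
    moreover have "{\<omega> \<in> space M. \<not> Y \<omega> \<noteq> y} = Y -` {y} \<inter> space M"
      by auto
    ultimately have "emeasure M (Y -` {y} \<inter> space M) = 0"
      by simp
    then show ?thesis
      by (simp add: emeasure_distr)
  qed
  then have half: "\<P>(\<omega> in M. Z \<omega> \<le> Y \<omega>) = 1/2"
    using indep_YZ assms(4,5) by (intro prob_le_iid_atomless) (simp_all only: distr_unif)

  have "p_error M X Y Z R h =
      \<P>(\<omega> in M. real_of_int \<lfloor>1 + X \<omega> + (real_of_int R + h)\<rfloor> + 1 + Z \<omega> - (2 + Y \<omega>) \<le> real_of_int R)"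
    \<comment> \<open>With \<open>l = R + h\<close> the conditioning event is the whole space, so
      the conditional probability is an ordinary one.\<close>
    by (simp add: p_error_def cond_prob_def s0_def s1_def t0_def t1_def prob_space)
  also have "\<dots> = \<P>(\<omega> in M. X \<omega> < 1 - h \<and> Z \<omega> \<le> Y \<omega>)"
  proof (rule prob_eq_AE)
    show "AE \<omega> in M. (real_of_int \<lfloor>1 + X \<omega> + (real_of_int R + h)\<rfloor> + 1 + Z \<omega> - (2 + Y \<omega>) \<le> real_of_int R)
        \<longleftrightarrow> X \<omega> < 1 - h \<and> Z \<omega> \<le> Y \<omega>"
      using assms(3,4,5)[THEN uniform_on_Icc_AE_mem]
      by eventually_elim (intro accept_iff assms(6))
  qed measurable
  also have "\<dots> = prob ((\<lambda>\<omega>. (X \<omega>, Y \<omega> - Z \<omega>)) -` ({..<1 - h} \<times> {0..}) \<inter> space M)"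
    by (auto intro!: arg_cong[where f = prob])
  also have "\<dots> = prob (X -` {..<1 - h} \<inter> space M) * prob ((\<lambda>\<omega>. Y \<omega> - Z \<omega>) -` {0..} \<inter> space M)"
    by (rule indep_varD[OF indep_X_YZ]) auto
  also have "\<dots> = \<P>(\<omega> in M. X \<omega> < 1 - h) * \<P>(\<omega> in M. Z \<omega> \<le> Y \<omega>)"
    by (intro arg_cong2[where f = "(*)"] arg_cong[where f = prob]) auto
  finally have p: "p_error M X Y Z R h = \<P>(\<omega> in M. X \<omega> < 1 - h) / 2"
    using half by simp

  show ?thesis
  proof (intro conjI impI; (elim conjE)?)
    assume "0 < h" "h \<le> 1/2"
    \<comment> \<open>Here \<open>1 - h\<close> may lie to the right of the range of
      \<open>X\<close>, outside the scope of the distribution formula, so the value at the endpoint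
      \<open>1/2\<close> is carried over by monotonicity.\<close>
    have "\<P>(\<omega> in M. X \<omega> < 1/2) \<le> \<P>(\<omega> in M. X \<omega> < 1 - h)"
      using \<open>h \<le> 1/2\<close> by (intro finite_measure_mono) auto
    moreover have "\<P>(\<omega> in M. X \<omega> < 1/2) = 1"
      using uniform_on_Icc_prob_less[OF assms(3), of "1/2"] by simp
    ultimately have "\<P>(\<omega> in M. X \<omega> < 1 - h) = 1"
      by (intro antisym) auto
    with p show "p_error M X Y Z R h = 1/2"
      by simp
  next
    assume "1/2 < h" "h < 1"
    \<comment> \<open>Now \<open>1 - h\<close> lies inside the range, and the factor
      \<open>2\<close> from the interval length cancels the \<open>1/2\<close> from
      \<open>Z \<le> Y\<close>.\<close>
    with p show "p_error M X Y Z R h = 1 - h"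
      using uniform_on_Icc_prob_less[OF assms(3), of "1 - h"] by simp
  next
    assume "h \<ge> 1"
    \<comment> \<open>Symmetrically, \<open>1 - h \<le> 0\<close> may lie to the left of the range;
      the comparison is with the endpoint \<open>0\<close>.\<close>
    have "\<P>(\<omega> in M. X \<omega> < 1 - h) \<le> \<P>(\<omega> in M. X \<omega> < 0)"
      using \<open>h \<ge> 1\<close> by (intro finite_measure_mono) auto
    moreover have "\<P>(\<omega> in M. X \<omega> < 0) = 0"
      using uniform_on_Icc_prob_less[OF assms(3), of 0] by simp
    ultimately have "\<P>(\<omega> in M. X \<omega> < 1 - h) = 0"
      using measure_nonneg[of M] by (intro antisym) auto
    with p show "p_error M X Y Z R h = 0"
      by simp
  qed
qed

end
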